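(* Let $\alpha_1$ and $\alpha_2$ be two circles of radius $a$ in the plane that touch each other externally, let $t$ be an external common tangent of $\alpha_1$ and $\alpha_2$, and let $\Delta$ be the curvilinear triangle made by $\alpha_1$, $\alpha_2$ and $t$. Let $n\ge 1$ be an integer. If $\beta_1, \beta_2, \dots, \beta_n$ are congruent circles on $t$ lying in $\Delta$ such that $\beta_1$ touches $\alpha_1$ at a point $C$ and $\beta_n$ touches $\alpha_2$ at a point $B$, and $A$ is the foot of the perpendicular from $B$ to $t$, then the following relations hold. (i) $n|AB|=|BC|$. (ii) $2a=\left(\left(\sqrt{n}+1\right)^2+1\right)|AB|$.
   Context: Circles $\gamma_1,\gamma_2,\dots,\gamma_n$ are called congruent circles on a line $s$ if they are congruent (have equal radii), all touch (are tangent to) $s$ from the same side, $\gamma_1$ and $\gamma_2$ touch each other, and for each $i=3,4,\dots,n$ the circle $\gamma_i$ touches $\gamma_{i-1}$ from the side opposite to $\gamma_1$ (so they form a row of distinct circles along $s$, each externally tangent to the next). For $n=1$ this just means a single circle touching $s$. The curvilinear triangle $\Delta$ is the bounded region enclosed between the two circles $\alpha_1,\alpha_2$ and the line $t$, i.e. bounded by the segment of $t$ between its tangency points with $\alpha_1$ and $\alpha_2$, and by the arcs of $\alpha_1$ and $\alpha_2$ from these points to the point of contact of $\alpha_1$ and $\alpha_2$; $\Delta$ lies outside both circles. The notation $|PQ|$ denotes the length of the segment $PQ$. *)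

theory Defs
  imports "HOL-Analysis.Analysis"
begin

type_synonym point = "real ^ 2"

definition is_line :: "point set \<Rightarrow> bool" where
  "is_line t \<longleftrightarrow> (\<exists>P Q. P \<noteq> Q \<and> t = affine hull {P, Q})"

text \<open>A circle of radius \<open>r > 0\<close> and a line, or two circles, are tangent precisely when they have
  exactly one common point; the following notion is only used for such sets.\<close>

definition touches_at :: "point set \<Rightarrow> point set \<Rightarrow> point \<Rightarrow> bool" where
  "touches_at S T P \<longleftrightarrow> S \<inter> T = {P}"

definition touches :: "point set \<Rightarrow> point set \<Rightarrow> bool" where
  "touches S T \<longleftrightarrow> (\<exists>P. touches_at S T P)"

definition circles_touch_externally :: "point \<Rightarrow> real \<Rightarrow> point \<Rightarrow> real \<Rightarrow> bool" where
  "circles_touch_externally c r d s \<longleftrightarrow>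
     touches (sphere c r) (sphere d s) \<and> ball c r \<inter> ball d s = {}"

definition same_side :: "point set \<Rightarrow> point \<Rightarrow> point \<Rightarrow> bool" where
  "same_side t P Q \<longleftrightarrow> closed_segment P Q \<inter> t = {}"

definition external_common_tangent ::
  "point set \<Rightarrow> point \<Rightarrow> real \<Rightarrow> point \<Rightarrow> real \<Rightarrow> bool" where
  "external_common_tangent t c r d s \<longleftrightarrow>
     is_line t \<and> touches (sphere c r) t \<and> touches (sphere d s) t \<and> same_side t c d"

definition foot_of_perpendicular :: "point \<Rightarrow> point \<Rightarrow> point set \<Rightarrow> bool" where
  "foot_of_perpendicular A B t \<longleftrightarrow> A \<in> t \<and> (\<forall>P\<in>t. orthogonal (B - A) (P - A))"

text \<open>The circles are \<open>sphere (c i) r\<close> for \<open>1 \<le> i \<le> n\<close>. The \<open>i\<close>-th circle touches its predecessor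
  from the side opposite to the first circle: the centre of the predecessor lies strictly between
  the centres of the first and the \<open>i\<close>-th circle.\<close>

definition congruent_circles_on ::
  "point set \<Rightarrow> nat \<Rightarrow> (nat \<Rightarrow> point) \<Rightarrow> real \<Rightarrow> bool" where
  "congruent_circles_on s n c r \<longleftrightarrow>
     r > 0 \<and>
     (\<forall>i\<in>{1..n}. touches (sphere (c i) r) s) \<and>
     (\<forall>i\<in>{1..n}. \<forall>j\<in>{1..n}. same_side s (c i) (c j)) \<and>
     (n \<ge> 2 \<longrightarrow> touches (sphere (c 1) r) (sphere (c 2) r)) \<and>
     (\<forall>i\<in>{3..n}. touches (sphere (c (i - 1)) r) (sphere (c i) r) \<and>
                  c (i - 1) \<in> open_segment (c 1) (c i))"

text \<open>For two externally touching circles and an external common tangent \<open>t\<close>, the bounded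
  components of the complement of the two circles and \<open>t\<close>, whose union is given by \<^const>\<open>inside\<close>,
  are the two open discs and the open curvilinear triangle. The closure adds its boundary, formed
  by two arcs and a segment of \<open>t\<close>.\<close>

definition curvilinear_triangle ::
  "point \<Rightarrow> real \<Rightarrow> point \<Rightarrow> real \<Rightarrow> point set \<Rightarrow> point set" where
  "curvilinear_triangle c r d s t =
     closure (inside (sphere c r \<union> sphere d s \<union> t) - (cball c r \<union> cball d s))"

end

theory Submission
  imports Defs
begin

text \<open>Put \<open>t\<close> on the \<open>x\<close>-axis and the centres of the two large circles at \<open>(-a, a)\<close> and \<open>(a, a)\<close>. Every
  \<open>\<beta>\<^sub>i\<close> has its centre at height \<open>r\<close>, and external tangency puts the centres of \<open>\<beta>\<^sub>1\<close> and \<open>\<beta>\<^sub>n\<close> at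
  \<open>x = \<plusminus>(2 \<surd>(a r) - a)\<close>. As the row has consecutive centres \<open>2 r\<close> apart, \<open>a - 2 \<surd>(a r) = r (n - 1)\<close>,
  that is \<open>(\<surd>a - \<surd>r)\<^sup>2 = n r\<close> and hence \<open>a = r (1 + \<surd>n)\<^sup>2\<close>. The contact points divide the segments
  joining the centres in the ratio \<open>r : a\<close>, so \<open>|AB| = 2 a r / (a + r)\<close> and
  \<open>|BC| = 2 a (1 - 2 \<surd>(a r) / (a + r))\<close>.\<close>

section \<open>Norms, touching circles and insides of sets\<close>

lemma parseval_2:
  fixes e f v :: point
  assumes "norm e = 1" "norm f = 1" "e \<bullet> f = 0"
  shows "(norm v)\<^sup>2 = (v \<bullet> e)\<^sup>2 + (v \<bullet> f)\<^sup>2"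
proof -
  have "e $ 1 * e $ 1 + e $ 2 * e $ 2 = 1" "f $ 1 * f $ 1 + f $ 2 * f $ 2 = 1"
    "e $ 1 * f $ 1 + e $ 2 * f $ 2 = 0"
    using assms by (simp_all add: norm_eq_1 inner_vec_def sum_2)
  \<comment> \<open>A square matrix with orthonormal rows has orthonormal columns.\<close>
  then have "e $ 1 * e $ 1 + f $ 1 * f $ 1 = 1" "e $ 2 * e $ 2 + f $ 2 * f $ 2 = 1"
    "e $ 1 * e $ 2 + f $ 1 * f $ 2 = 0"
    by algebra+
  then have "v $ 1 * v $ 1 + v $ 2 * v $ 2 =
      (v $ 1 * e $ 1 + v $ 2 * e $ 2)\<^sup>2 + (v $ 1 * f $ 1 + v $ 2 * f $ 2)\<^sup>2"
    by algebra
  then show ?thesis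
    by (simp add: power2_norm_eq_inner inner_vec_def sum_2)
qed

text \<open>Point reflection in the midpoint of the centres swaps circles of equal radius. Hence it
  fixes their only common point, which is therefore that midpoint.\<close>

lemma touches_equal_radius_dist:
  assumes "touches (sphere p r) (sphere q r)"
  shows "dist p q = 2 * r"
proof -
  obtain Q where Q: "sphere p r \<inter> sphere q r = {Q}"
    using assms by (auto simp: touches_def touches_at_def)
  then have d: "dist p Q = r" "dist q Q = r"
    by (auto simp: set_eq_iff)
  then have "p + q - Q \<in> sphere p r \<inter> sphere q r"
    by (simp add: dist_norm norm_minus_commute)
  then have "p + q - Q = Q"
    using Q by blast
  then have "p - q = 2 *\<^sub>R (p - Q)"
    by (simp add: algebra_simps scaleR_2)
  then show ?thesis
    using d by (simp add: dist_norm)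
qed

text \<open>The ray is a connected unbounded subset of the complement, so the component of
  \<open>p\<close> is unbounded.\<close>

lemma ray_avoids_imp_not_inside:
  fixes p v :: "'a::real_normed_vector"
  assumes "v \<noteq> 0" and avoid: "\<And>s. s \<ge> 0 \<Longrightarrow> p + s *\<^sub>R v \<notin> S"
  shows "p \<notin> inside S"
proof
  assume "p \<in> inside S"
  then have bd: "bounded (connected_component_set (- S) p)"
    by (simp add: inside_def)
  let ?R = "(\<lambda>s. p + s *\<^sub>R v) ` {0..}"
  have "connected ?R"
    by (intro connected_continuous_image continuous_intros) auto
  moreover have "p \<in> ?R"
    by (intro image_eqI[of _ _ 0]) auto
  moreover have "?R \<subseteq> - S"
    using avoid by auto
  ultimately have "?R \<subseteq> connected_component_set (- S) p"
    by (intro connected_component_maximal)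
  then have "bounded ?R"
    using bd bounded_subset by blast
  then obtain B where B: "\<And>s. s \<ge> 0 \<Longrightarrow> norm (p + s *\<^sub>R v) \<le> B"
    unfolding bounded_iff by auto
  define s where "s = (\<bar>B\<bar> + norm p + 1) / norm v"
  have "s \<ge> 0"
    by (simp add: s_def)
  have "norm (s *\<^sub>R v) = \<bar>B\<bar> + norm p + 1"
    using assms(1) by (simp add: s_def)
  moreover have "norm (s *\<^sub>R v) \<le> norm (p + s *\<^sub>R v) + norm p"
    using norm_triangle_ineq4[of "p + s *\<^sub>R v" p] by simp
  ultimately show False
    using B[OF \<open>s \<ge> 0\<close>] by linarith
qed

text \<open>The common point \<open>C\<close> gives \<open>dist b c \<le> r + a\<close>; a point of
  the small circle kept out of the big disc gives the converse. Equality in the triangle inequality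
  then places \<open>C\<close> on the segment between the centres.\<close>

lemma external_contact_point:
  fixes b c C :: "'a::euclidean_space"
  assumes "0 < r" "r < a" "sphere b r \<inter> ball c a = {}"
    and C: "C \<in> sphere b r" "C \<in> sphere c a"
  shows "dist b c = r + a" "(r + a) *\<^sub>R C = r *\<^sub>R c + a *\<^sub>R b"
proof -
  have d: "dist b C = r" "dist C c = a"
    using C by (auto simp: dist_commute)
  have "b \<noteq> c"
    using d assms(2) by (auto simp: dist_commute)
  then have pos: "dist b c > 0"
    by simp
  \<comment> \<open>The point of the small circle in the direction of \<open>c\<close>.\<close>
  define Q where "Q = b + (r / dist b c) *\<^sub>R (c - b)"
  have "dist b Q = r"
    using assms(1) pos by (simp add: Q_def dist_norm norm_minus_commute)
  then have "dist c Q \<ge> a"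
    using assms(3) by (auto simp: disjoint_iff)
  moreover have "c - Q = (1 - r / dist b c) *\<^sub>R (c - b)"
    by (simp add: Q_def algebra_simps)
  then have "dist c Q = \<bar>1 - r / dist b c\<bar> * dist b c"
    by (simp add: dist_norm norm_minus_commute)
  then have "dist c Q = \<bar>(1 - r / dist b c) * dist b c\<bar>"
    by (simp add: abs_mult)
  then have "dist c Q = \<bar>dist b c - r\<bar>"
    using pos by (simp add: left_diff_distrib)
  \<comment> \<open>The other sign of the absolute value, \<open>r - dist b c \<ge> a\<close>,
    contradicts \<open>r < a\<close>.\<close>
  ultimately have "dist b c \<ge> r + a"
    using assms(2) pos by linarith
  moreover have "dist b c \<le> r + a"
    using dist_triangle[of b c C] d by simp
  ultimately show eq: "dist b c = r + a"
    by simp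
  then have "norm (b - C) *\<^sub>R (C - c) = norm (C - c) *\<^sub>R (b - C)"
    using d by (simp flip: dist_triangle_eq)
  then show "(r + a) *\<^sub>R C = r *\<^sub>R c + a *\<^sub>R b"
    using d by (simp add: dist_norm algebra_simps)
qed

section \<open>Coordinates in an orthonormal frame\<close>

text \<open>No orientation is fixed, so \<open>f\<close> can point to the side of the circles
  independently of the direction of \<open>e\<close>.\<close>

locale orthonormal_frame =
  fixes c0 e f :: point
  assumes norm_e: "norm e = 1" and norm_f: "norm f = 1" and orth: "e \<bullet> f = 0"
begin

definition X :: "point \<Rightarrow> real" where "X p = (p - c0) \<bullet> e"
definition Y :: "point \<Rightarrow> real" where "Y p = (p - c0) \<bullet> f"
definition pt :: "real \<Rightarrow> real \<Rightarrow> point" where "pt x y = c0 + x *\<^sub>R e + y *\<^sub>R f"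

lemma inner_frame [simp]: "e \<bullet> e = 1" "f \<bullet> f = 1" "e \<bullet> f = 0" "f \<bullet> e = 0"
  using norm_e norm_f orth by (simp_all add: norm_eq_1 inner_commute[of f e])

lemma X_pt [simp]: "X (pt x y) = x" and Y_pt [simp]: "Y (pt x y) = y"
  by (simp_all add: X_def Y_def pt_def inner_simps)

lemma X_add [simp]: "X (p + s *\<^sub>R e) = X p + s" "X (p + s *\<^sub>R f) = X p"
  and Y_add [simp]: "Y (p + s *\<^sub>R e) = Y p" "Y (p + s *\<^sub>R f) = Y p + s"
  by (simp_all add: X_def Y_def inner_simps)

lemma continuous_X [continuous_intros]: "continuous_on S X"
  and continuous_Y [continuous_intros]: "continuous_on S Y"
  unfolding X_def[abs_def] Y_def[abs_def] by (intro continuous_intros)+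

lemma dist_sq: "(dist p q)\<^sup>2 = (X p - X q)\<^sup>2 + (Y p - Y q)\<^sup>2"
proof -
  have "X p - X q = (p - q) \<bullet> e" "Y p - Y q = (p - q) \<bullet> f"
    by (simp_all add: X_def Y_def inner_simps)
  then show ?thesis
    using parseval_2[OF norm_e norm_f orth, of "p - q"] by (simp add: dist_norm)
qed

lemma dist_eq: "dist p q = sqrt ((X p - X q)\<^sup>2 + (Y p - Y q)\<^sup>2)"
  by (simp flip: dist_sq)

lemma pt_X_Y [simp]: "pt (X p) (Y p) = p"
proof -
  have "dist (pt (X p) (Y p)) p = 0"
    by (simp add: dist_eq)
  then show ?thesis by simp
qed

text \<open>The weights on both sides have the same sum, so the origin \<open>c0\<close>
  cancels.\<close>

lemma affine_relation_coords:
  assumes "(r + s) *\<^sub>R p = r *\<^sub>R q + s *\<^sub>R q'"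
  shows "(r + s) * X p = r * X q + s * X q'" "(r + s) * Y p = r * Y q + s * Y q'"
  using arg_cong[OF assms, of "\<lambda>v. v \<bullet> e"] arg_cong[OF assms, of "\<lambda>v. v \<bullet> f"]
  by (simp_all add: X_def Y_def inner_simps algebra_simps)

text \<open>Reflection in the perpendicular to the axis through \<open>c\<close> preserves circle
  and axis. The only common point is thus fixed, so it is the foot of that perpendicular.\<close>

lemma touches_axis_abs_Y:
  assumes "touches (sphere c r) {p. Y p = 0}"
  shows "\<bar>Y c\<bar> = r"
proof -
  obtain Q where Q: "sphere c r \<inter> {p. Y p = 0} = {Q}"
    using assms by (auto simp: touches_def touches_at_def)
  then have Q': "dist c Q = r" "Y Q = 0"
    by (auto simp: set_eq_iff)
  have "dist c (pt (2 * X c - X Q) 0) = r"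
    using Q' by (simp add: dist_eq power2_commute)
  then have "pt (2 * X c - X Q) 0 \<in> sphere c r \<inter> {p. Y p = 0}"
    by simp
  then have "pt (2 * X c - X Q) 0 = Q"
    using Q by blast
  then have "2 * X c - X Q = X Q"
    by (metis X_pt)
  then show ?thesis
    using Q' by (simp add: dist_eq)
qed

lemma same_side_axis:
  assumes "same_side {p. Y p = 0} p q"
  shows "Y p * Y q > 0"
proof (rule ccontr)
  assume "\<not> Y p * Y q > 0"
  then have "Y p \<le> 0 \<and> 0 \<le> Y q \<or> Y q \<le> 0 \<and> 0 \<le> Y p"
    by (metis linear mult_nonneg_nonneg mult_nonpos_nonpos mult_eq_0_iff order_le_less)
  \<comment> \<open>The axis is the hyperplane \<open>f \<bullet> z = f \<bullet> c0\<close>, ready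
    for the intermediate value theorem on the segment.\<close>
  then have "f \<bullet> p \<le> f \<bullet> c0 \<and> f \<bullet> c0 \<le> f \<bullet> q \<or> f \<bullet> q \<le> f \<bullet> c0 \<and> f \<bullet> c0 \<le> f \<bullet> p"
    by (auto simp: Y_def inner_simps inner_commute)
  then obtain z where "z \<in> closed_segment p q" "f \<bullet> z = f \<bullet> c0"
    using connected_ivt_hyperplane[OF connected_segment(1), of p p q q f "f \<bullet> c0"]
      connected_ivt_hyperplane[OF connected_segment(1), of q p q p f "f \<bullet> c0"]
    by auto
  then have "z \<in> closed_segment p q \<inter> {p. Y p = 0}"
    by (simp add: Y_def inner_simps inner_commute)
  then show False
    using assms by (auto simp: same_side_def)
qed

lemma dist_foot_of_perpendicular_axis:
  assumes "foot_of_perpendicular A B {p. Y p = 0}"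
  shows "dist A B = \<bar>Y B\<bar>"
proof -
  \<comment> \<open>\<open>A + e\<close> serves as a second point of the axis; the factor 1 lets
    \<open>Y_add\<close> apply.\<close>
  have "Y A = 0" "Y (A + 1 *\<^sub>R e) = 0"
    using assms by (auto simp: foot_of_perpendicular_def simp del: scaleR_one)
  then have "orthogonal (B - A) (A + 1 *\<^sub>R e - A)"
    using assms by (simp only: foot_of_perpendicular_def mem_Collect_eq)
  then have "X A = X B"
    by (simp add: orthogonal_def X_def inner_simps)
  with \<open>Y A = 0\<close> show ?thesis
    by (simp add: dist_eq)
qed

section \<open>The curvilinear triangle in coordinates\<close>

lemma curvilinear_triangle_bounds:
  assumes a: "a > 0"
    and p: "p \<in> curvilinear_triangle (pt (- a) a) a (pt a a) a {p. Y p = 0}"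
  shows "0 \<le> Y p" "Y p \<le> a" "\<bar>X p\<bar> \<le> a" "dist (pt (- a) a) p \<ge> a" "dist (pt a a) p \<ge> a"
proof -
  let ?c = "pt (- a) a" and ?d = "pt a a" and ?t = "{p. Y p = 0}"
  let ?S = "sphere ?c a \<union> sphere ?d a \<union> ?t"
  let ?K = "{p. 0 \<le> Y p} \<inter> {p. Y p \<le> a} \<inter> {p. \<bar>X p\<bar> \<le> a} \<inter> {p. a \<le> dist ?c p} \<inter> {p. a \<le> dist ?d p}"
  \<comment> \<open>A point of \<open>- ?S\<close> outside the discs and off \<open>?K\<close> starts a ray missing \<open>?S\<close>, in direction \<open>\<plusminus>e\<close> or \<open>\<plusminus>f\<close>.\<close>
  have "closed ?K"
    by (intro closed_Int closed_Collect_le continuous_intros)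
  moreover have "inside ?S - (cball ?c a \<union> cball ?d a) \<subseteq> ?K"
  proof
    fix q assume q: "q \<in> inside ?S - (cball ?c a \<union> cball ?d a)"
    then have q_inside: "q \<in> inside ?S" and cd: "dist ?c q > a" "dist ?d q > a"
      by auto
    have "q \<notin> ?S"
      using inside_no_overlap[of ?S] q_inside by blast
    then have "Y q \<noteq> 0" by auto
    have sq: "a\<^sup>2 < (X q + a)\<^sup>2 + (Y q - a)\<^sup>2" "a\<^sup>2 < (X q - a)\<^sup>2 + (Y q - a)\<^sup>2"
      using power_strict_mono[OF cd(1), of 2] power_strict_mono[OF cd(2), of 2] a
      by (auto simp: dist_commute[of _ q] dist_sq)
    have sphere: "\<And>x y q. q \<in> sphere (pt x y) a \<Longrightarrow> a\<^sup>2 = (X q - x)\<^sup>2 + (Y q - y)\<^sup>2"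
      using dist_sq by (simp add: power2_commute) (metis X_pt Y_pt power2_commute)
    have not_S: "q' \<notin> ?S" if "Y q' \<noteq> 0" "a\<^sup>2 < (X q' + a)\<^sup>2 + (Y q' - a)\<^sup>2"
        "a\<^sup>2 < (X q' - a)\<^sup>2 + (Y q' - a)\<^sup>2" for q'
      using that sphere[of q' "-a" a] sphere[of q' a a] by auto
    have ne: "e \<noteq> 0" "f \<noteq> 0" "- e \<noteq> 0" "- f \<noteq> 0"
      using norm_e norm_f by auto
    have ray: False if "v \<noteq> 0" "\<And>s. s \<ge> 0 \<Longrightarrow> q + s *\<^sub>R v \<notin> ?S" for v
      using ray_avoids_imp_not_inside[of v q ?S] that q_inside by blast
    have "0 \<le> Y q"
    proof (rule ccontr)
      assume neg: "\<not> 0 \<le> Y q"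
      show False
      proof (rule ray[OF ne(4)])
        fix s :: real assume "s \<ge> 0"
        \<comment> \<open>Below the axis, the height difference to the two centres alone exceeds
          \<open>a\<close>.\<close>
        then have "a\<^sup>2 < (Y q - s - a)\<^sup>2"
          using neg a by (intro power2_strict_mono) auto
        then show "q + s *\<^sub>R (- f) \<notin> ?S"
          using neg \<open>s \<ge> 0\<close> Y_add(2)[of q "- s"] X_add(2)[of q "- s"]
          by (intro not_S) (auto intro: add_nonneg_pos less_le_trans)
      qed
    qed
    moreover have "Y q \<le> a"
    proof (rule ccontr)
      assume "\<not> Y q \<le> a"
      show False
      proof (rule ray[OF ne(2)])
        fix s :: real assume "s \<ge> 0"
        \<comment> \<open>Above the common height of the centres, going up increases the distance to
          both.\<close>
        then have "(Y q - a)\<^sup>2 \<le> (Y q + s - a)\<^sup>2"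
          using \<open>\<not> Y q \<le> a\<close> by (intro power_mono) auto
        then show "q + s *\<^sub>R f \<notin> ?S"
          using \<open>\<not> Y q \<le> a\<close> \<open>s \<ge> 0\<close> a sq by (intro not_S; simp; linarith)
      qed
    qed
    moreover have "X q \<le> a"
    proof (rule ccontr)
      assume "\<not> X q \<le> a"
      show False
      proof (rule ray[OF ne(1)])
        fix s :: real assume "s \<ge> 0"
        \<comment> \<open>Right of both centres, going right increases both horizontal offsets, and
          the constant nonzero height misses the axis.\<close>
        then have "(X q - a)\<^sup>2 \<le> (X q + s - a)\<^sup>2" "(X q + a)\<^sup>2 \<le> (X q + s + a)\<^sup>2"
          using \<open>\<not> X q \<le> a\<close> a by (auto intro!: power_mono)
        then show "q + s *\<^sub>R e \<notin> ?S"
          using \<open>Y q \<noteq> 0\<close> a sq by (intro not_S; simp; linarith)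
      qed
    qed
    moreover have "- a \<le> X q"
    proof (rule ccontr)
      assume "\<not> - a \<le> X q"
      show False
      proof (rule ray[OF ne(3)])
        fix s :: real assume "s \<ge> 0"
        \<comment> \<open>The mirror case; the minus signs make the bases nonnegative for
          \<open>power_mono\<close>.\<close>
        then have "(- (X q - a))\<^sup>2 \<le> (- (X q - s - a))\<^sup>2" "(- (X q + a))\<^sup>2 \<le> (- (X q - s + a))\<^sup>2"
          using \<open>\<not> - a \<le> X q\<close> a by (intro power_mono; simp)+
        then have "(X q - a)\<^sup>2 \<le> (X q - s - a)\<^sup>2" "(X q + a)\<^sup>2 \<le> (X q - s + a)\<^sup>2"
          by (simp_all only: power2_minus)
        then show "q + s *\<^sub>R (- e) \<notin> ?S"
          using \<open>Y q \<noteq> 0\<close> a sq Y_add(1)[of q "- s"] X_add(1)[of q "- s"]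
          by (intro not_S; simp; linarith)
      qed
    qed
    ultimately show "q \<in> ?K"
      using cd by auto
  qed
  \<comment> \<open>As \<open>?K\<close> is closed, the bounds pass from the open region to its
    closure.\<close>
  ultimately have "p \<in> ?K"
    using p closure_minimal unfolding curvilinear_triangle_def by blast
  then show "0 \<le> Y p" "Y p \<le> a" "\<bar>X p\<bar> \<le> a" "dist ?c p \<ge> a" "dist ?d p \<ge> a"
    by auto
qed

text \<open>It suffices to test the lowest, highest, leftmost and rightmost points of the circle
  against the bounds of the triangle.\<close>

lemma circle_in_triangle_position:
  assumes "a > 0" "r > 0" "\<bar>Y b\<bar> = r"
    and sub: "sphere b r \<subseteq> curvilinear_triangle (pt (- a) a) a (pt a a) a {p. Y p = 0}"
  shows "Y b = r" "2 * r \<le> a" "\<bar>X b\<bar> \<le> a"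
proof -
  have "pt (X b) (Y b - r) \<in> sphere b r" "pt (X b) (Y b + r) \<in> sphere b r"
    "pt (X b - r) (Y b) \<in> sphere b r" "pt (X b + r) (Y b) \<in> sphere b r"
    using \<open>r > 0\<close> by (simp_all add: dist_eq)
  then have "0 \<le> Y b - r" "Y b + r \<le> a" "\<bar>X b - r\<bar> \<le> a" "\<bar>X b + r\<bar> \<le> a"
    using sub curvilinear_triangle_bounds[OF \<open>a > 0\<close>] X_pt Y_pt by (metis subsetD)+
  then show "Y b = r" "2 * r \<le> a" "\<bar>X b\<bar> \<le> a"
    using assms(2,3) by linarith+
qed

section \<open>Rows of congruent circles\<close>

text \<open>All centres have height \<open>r\<close>, so each contact is a horizontal step of length
  \<open>2 * r\<close>. The first step fixes the sign \<open>\<epsilon>\<close>, and betweenness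
  forbids any later step back.\<close>

lemma row_of_circles_X:
  assumes row: "congruent_circles_on t n b r"
    and Yb: "\<And>i. i \<in> {1..n} \<Longrightarrow> Y (b i) = r"
  shows "\<exists>\<epsilon>\<in>{1, - 1}. \<forall>i\<in>{1..n}. X (b i) - X (b 1) = \<epsilon> * 2 * r * (real i - 1)"
proof (cases "n \<ge> 2")
  \<comment> \<open>Only \<open>i = 1\<close> can occur, where both sides vanish.\<close>
  case False
  then show ?thesis
    by (intro bexI[of _ 1]) (auto simp: not_le less_Suc_eq numeral_2_eq_2)
next
  case True
  have r: "r > 0"
    using row by (simp add: congruent_circles_on_def)
  have X_diff: "\<bar>X (b i) - X (b j)\<bar> = 2 * r"
    if "touches (sphere (b i) r) (sphere (b j) r)" "i \<in> {1..n}" "j \<in> {1..n}" for i j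
    using touches_equal_radius_dist[OF that(1)] Yb that by (simp add: dist_eq)
  have "\<bar>X (b 1) - X (b 2)\<bar> = 2 * r"
    using row True by (intro X_diff) (auto simp: congruent_circles_on_def)
  then obtain \<epsilon> :: real where \<epsilon>: "\<epsilon> \<in> {1, - 1}" "X (b 2) - X (b 1) = \<epsilon> * 2 * r"
    by (auto simp: abs_if split: if_splits intro: that[of 1] that[of "- 1"])
  have sq: "\<epsilon> * \<epsilon> = 1" "\<epsilon> * (\<epsilon> * x) = x" for x
    using \<epsilon>(1) by auto
  have "X (b i) - X (b 1) = \<epsilon> * 2 * r * (real i - 1)" if "1 \<le> i" "i \<le> n" for i
    using that
  proof (induction i rule: dec_induct)
    case base
    then show ?case by simp
  next
    case (step i)
    show ?case
    proof (cases "i = 1")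
      case True
      then show ?thesis using \<epsilon> by (simp add: numeral_2_eq_2)
    next
      case False
      \<comment> \<open>\<open>k\<close> counts the steps from the first centre to the
        \<open>i\<close>-th; \<open>D\<close> is the offset of the next centre, measured in the
        direction of the row.\<close>
      define k where "k = real i - 1"
      define D where "D = \<epsilon> * (X (b (Suc i)) - X (b 1))"
      have k: "k > 0"
        using False step by (simp add: k_def)
      have IH: "X (b i) - X (b 1) = \<epsilon> * 2 * r * k"
        using step by (simp add: k_def)
      have i: "Suc i \<in> {3..n}"
        using False step by auto
      have touch: "touches (sphere (b i) r) (sphere (b (Suc i)) r)"
        and between: "b i \<in> open_segment (b 1) (b (Suc i))"
        using row i unfolding congruent_circles_on_def by (metis diff_Suc_1)+
      have "\<bar>\<epsilon> * (X (b i) - X (b (Suc i)))\<bar> = 2 * r"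
        using X_diff[OF touch] i \<epsilon>(1) by auto
      moreover have "\<epsilon> * (X (b i) - X (b (Suc i))) = 2 * r * k - D"
        using IH sq(1) by (simp add: D_def) algebra
      ultimately have "D = 2 * r * k + 2 * r \<or> D = 2 * r * k - 2 * r"
        by linarith
      moreover obtain u where u: "0 < u" "u < 1" "b i = (1 - u) *\<^sub>R b 1 + u *\<^sub>R b (Suc i)"
        using between by (auto simp: in_segment)
      have "X (b i) = (1 - u) * X (b 1) + u * X (b (Suc i))"
        using u(3) affine_relation_coords(1)[of "1 - u" u "b i" "b 1" "b (Suc i)"] by simp
      \<comment> \<open>With \<open>0 < u < 1\<close> this forces \<open>D > 2 * r * k\<close>,
        which excludes the step back.\<close>
      then have uD: "2 * r * k = u * D"
        using IH sq(1) unfolding D_def by algebra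
      have "D > 0"
        using r k u(1) uD by (metis mult_pos_pos zero_less_mult_pos zero_less_numeral)
      then have "2 * r * k < D"
        using uD u(2) by simp
      ultimately have "D = 2 * r * (k + 1)"
        using r by (auto simp: algebra_simps)
      then have "X (b (Suc i)) - X (b 1) = \<epsilon> * (2 * r * (k + 1))"
        using sq(2) by (metis D_def)
      then show ?thesis
        by (simp add: k_def)
    qed
  qed
  then show ?thesis
    using \<epsilon>(1) by auto
qed

end

text \<open>\<open>width\<close> equates two values of \<open>X (b n) - X (b 1)\<close>: one from
  the contacts with the large circles, one from the row, whose direction \<open>\<epsilon>\<close>
  is still unknown.\<close>

lemma row_width_imp_radius_ratio:
  fixes a r \<epsilon> :: real and n :: nat
  assumes "0 < r" "2 * r \<le> a" "n \<ge> 1" "\<epsilon> \<in> {1, - 1}"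
    and width: "2 * a - 4 * (sqrt a * sqrt r) = \<epsilon> * 2 * r * (real n - 1)"
  shows "sqrt a = sqrt r * (1 + sqrt n)"
proof -
  define p q m where "p = sqrt a" and "q = sqrt r" and "m = real n"
  have a: "a = p\<^sup>2" and r: "r = q\<^sup>2" and q: "q > 0" and pq: "q < p" and m: "m \<ge> 1"
    using assms by (auto simp: p_def q_def m_def)
  have width': "2 * p\<^sup>2 - 4 * (p * q) = \<epsilon> * 2 * q\<^sup>2 * (m - 1)"
    using width unfolding p_def[symmetric] q_def[symmetric] m_def[symmetric] a[symmetric] r[symmetric] .
  have "a - 2 * p * q = r * (m - 1)"
  proof (cases "\<epsilon> = 1 \<or> n = 1")
    case True
    then show ?thesis using width' assms(4) by (auto simp: a r m_def)
  next
    \<comment> \<open>A row running from the second large circle back to the first would force \<open>(\<surd>a - \<surd>r)\<^sup>2 + r (n - 2) = 0\<close>.\<close>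
    case False
    then have "m \<ge> 2" and "\<epsilon> = - 1"
      using assms by (auto simp: m_def)
    then have "(p - q)\<^sup>2 + r * (m - 2) = 0"
      using width' unfolding r by algebra
    moreover have "(p - q)\<^sup>2 > 0" "r * (m - 2) \<ge> 0"
      using pq \<open>m \<ge> 2\<close> assms(1) by auto
    ultimately show ?thesis by linarith
  qed
  \<comment> \<open>Adding \<open>r = q\<^sup>2\<close> completes the square; \<open>q < p\<close>
    then selects the positive root.\<close>
  then have "(p - q)\<^sup>2 = (q * sqrt m)\<^sup>2"
    using m unfolding a r by (simp add: power_mult_distrib power2_diff algebra_simps)
  then have "p - q = q * sqrt m"
    by (rule power2_eq_imp_eq) (use pq q m in simp_all)
  then show ?thesis
    by (simp add: p_def q_def m_def algebra_simps)
qed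

section \<open>The two relations in coordinates\<close>

text \<open>In terms of \<open>s = 1 + sqrt n\<close> one has \<open>a = r * s\<^sup>2\<close> and
  \<open>sqrt (a * r) = r * s\<close>, so both relations reduce to polynomial identities in
  \<open>r\<close> and \<open>s\<close>.\<close>

lemma (in orthonormal_frame) row_relations_in_frame:
  fixes a :: real
  defines "c1 \<equiv> pt (- a) a" and "c2 \<equiv> pt a a" and "t \<equiv> {p. Y p = 0}"
  assumes a: "a > 0" and n: "n \<ge> 1"
    and row: "congruent_circles_on t n b r"
    and sub: "\<And>i. i \<in> {1..n} \<Longrightarrow> sphere (b i) r \<subseteq> curvilinear_triangle c1 a c2 a t"
    and C: "touches_at (sphere (b 1) r) (sphere c1 a) C"
    and B: "touches_at (sphere (b n) r) (sphere c2 a) B"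
    and foot: "foot_of_perpendicular A B t"
  shows "real n * dist A B = dist B C \<and> 2 * a = ((sqrt (real n) + 1)\<^sup>2 + 1) * dist A B"
proof -
  have r: "r > 0"
    using row by (simp add: congruent_circles_on_def)
  have pos: "Y (b i) = r" "2 * r \<le> a" "\<bar>X (b i)\<bar> \<le> a" if "i \<in> {1..n}" for i
  proof -
    have "\<bar>Y (b i)\<bar> = r"
      using row that by (auto simp: congruent_circles_on_def t_def intro!: touches_axis_abs_Y)
    then show "Y (b i) = r" "2 * r \<le> a" "\<bar>X (b i)\<bar> \<le> a"
      using circle_in_triangle_position[OF a r _ sub[OF that, unfolded c1_def c2_def t_def]] by auto
  qed
  have ra: "2 * r \<le> a" "r < a" and n1: "1 \<in> {1..n}" and nn: "n \<in> {1..n}"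
    using pos(2)[of 1] n r by auto
  \<comment> \<open>Points of the triangle keep distance at least \<open>a\<close> from the large
    centres, so the contacts at \<open>B\<close> and \<open>C\<close> are external.\<close>
  have disj: "sphere (b i) r \<inter> ball c1 a = {}" "sphere (b i) r \<inter> ball c2 a = {}"
    if "i \<in> {1..n}" for i
    using sub[OF that] curvilinear_triangle_bounds(4,5)[OF a]
    unfolding c1_def c2_def t_def by fastforce+
  have "C \<in> sphere (b 1) r" "C \<in> sphere c1 a" "B \<in> sphere (b n) r" "B \<in> sphere c2 a"
    using B C by (auto simp: touches_at_def)
  note contact_C = external_contact_point[OF r ra(2) disj(1)[OF n1] this(1,2)]
    and contact_B = external_contact_point[OF r ra(2) disj(2)[OF nn] this(3,4)]
  define s where "s = 1 + sqrt (real n)"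
  define q where "q = sqrt a * sqrt r"
  have q: "q \<ge> 0" "q\<^sup>2 = a * r"
    using a r by (auto simp: q_def power_mult_distrib)
  \<comment> \<open>Pythagoras with heights \<open>r\<close> and \<open>a\<close>:
    \<open>(r + a)\<^sup>2 - (a - r)\<^sup>2 = 4 * a * r\<close>.\<close>
  have "(X (b 1) + a)\<^sup>2 = (2 * q)\<^sup>2" "(a - X (b n))\<^sup>2 = (2 * q)\<^sup>2"
    using contact_C(1) contact_B(1) dist_sq[of "b 1" c1] dist_sq[of "b n" c2]
      pos(1)[OF n1] pos(1)[OF nn] q(2)
    unfolding c1_def c2_def by (auto simp: power2_eq_square algebra_simps)
  \<comment> \<open>\<open>\<bar>X (b i)\<bar> \<le> a\<close> makes both left sides
    nonnegative.\<close>
  then have "X (b 1) + a = 2 * q" "a - X (b n) = 2 * q"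
    using pos(3)[OF n1] pos(3)[OF nn] q(1)
    by (intro power2_eq_imp_eq[of "X (b 1) + a" "2 * q"] power2_eq_imp_eq[of "a - X (b n)" "2 * q"]; linarith)+
  then have X1: "X (b 1) = 2 * q - a" and Xn: "X (b n) = a - 2 * q"
    by auto
  obtain \<epsilon> where \<epsilon>: "\<epsilon> \<in> {1, - 1}" "X (b n) - X (b 1) = \<epsilon> * 2 * r * (real n - 1)"
    using row_of_circles_X[OF row pos(1)] nn by blast
  have "2 * a - 4 * (sqrt a * sqrt r) = \<epsilon> * 2 * r * (real n - 1)"
    using \<epsilon>(2) unfolding X1 Xn q_def by simp
  then have sqrt_a: "sqrt a = sqrt r * s"
    unfolding s_def using r ra(1) n \<epsilon>(1) by (intro row_width_imp_radius_ratio)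
  then have "(sqrt a)\<^sup>2 = (sqrt r * s)\<^sup>2"
    by simp
  then have a_eq: "a = r * s\<^sup>2"
    using a r by (simp add: power_mult_distrib)
  have q_eq: "q = r * s"
    using r by (simp add: q_def sqrt_a flip: power2_eq_square)
  have s: "s\<^sup>2 + 1 > 0" "(s - 1)\<^sup>2 = real n"
    by (auto simp: s_def add_nonneg_pos)
  have YB: "(r + a) * Y B = 2 * a * r" and XB: "(r + a) * X B = r * a + a * (a - 2 * q)"
    using affine_relation_coords[OF contact_B(2)] pos(1)[OF nn] by (simp_all add: c2_def Xn del: One_nat_def)
  have YC: "(r + a) * Y C = 2 * a * r" and XC: "(r + a) * X C = - (r * a) + a * (2 * q - a)"
    using affine_relation_coords[OF contact_C(2)] pos(1)[OF n1] by (simp_all add: c1_def X1 del: One_nat_def)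
  have ra_eq: "r + a = r * (s\<^sup>2 + 1)"
    by (simp add: a_eq algebra_simps)
  have YB': "(s\<^sup>2 + 1) * Y B = 2 * a"
    using YB r unfolding ra_eq by simp
  \<comment> \<open>\<open>B\<close> and \<open>C\<close> have equal height, so
    \<open>dist B C\<close> is a difference of abscissas.\<close>
  have "(r + a) * (Y B - Y C) = 0"
    using YB YC by (simp add: algebra_simps)
  then have "Y B = Y C"
    using r a by simp
  have "Y B > 0"
    using YB' a s(1) by (metis zero_less_mult_pos mult_pos_pos zero_less_numeral)
  \<comment> \<open>The factor \<open>r + a - 2 * q\<close> equals
    \<open>r * (s - 1)\<^sup>2\<close>, and \<open>(s - 1)\<^sup>2\<close> is
    \<open>n\<close>.\<close>
  have "r * (s\<^sup>2 + 1) * (X B - X C) = r * (2 * a * (s - 1)\<^sup>2)"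
    using XB XC unfolding ra_eq q_eq a_eq by algebra
  then have "(s\<^sup>2 + 1) * (X B - X C) = (s\<^sup>2 + 1) * (real n * Y B)"
    using r YB' s(2) by (simp add: mult.assoc)
  then have "X B - X C = real n * Y B"
    using s(1) by simp
  then have "dist B C = real n * Y B"
    using \<open>Y B = Y C\<close> \<open>Y B > 0\<close> by (simp add: dist_eq)
  moreover have "dist A B = Y B"
    using dist_foot_of_perpendicular_axis foot \<open>Y B > 0\<close> by (simp add: t_def)
  ultimately show ?thesis
    using YB' by (simp add: s_def add.commute)
qed

section \<open>A frame adapted to the tangent and the large circles\<close>

lemma line_eq_axis:
  assumes "is_line t"
  obtains P u v where "orthonormal_frame u v" "t = {p. orthonormal_frame.Y P v p = 0}"
proof -
  obtain P Q where PQ: "P \<noteq> Q" "t = affine hull {P, Q}"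
    using assms by (auto simp: is_line_def)
  define d where "d = norm (Q - P)"
  define u where "u = (1 / d) *\<^sub>R (Q - P)"
  \<comment> \<open>\<open>u\<close> turned by a right angle.\<close>
  define v :: point where "v = vector [- u $ 2, u $ 1]"
  have d: "d > 0" and u: "norm u = 1"
    using PQ by (auto simp: d_def u_def)
  have Q: "Q - P = d *\<^sub>R u"
    using d by (simp add: u_def)
  interpret orthonormal_frame P u v
    using u by unfold_locales (simp_all add: norm_eq_1 v_def inner_vec_def sum_2)
  have "t = range (\<lambda>s. P + s *\<^sub>R (Q - P))"
    by (simp add: PQ affine_hull_2_alt)
  also have "\<dots> = {p. Y p = 0}"
  proof (intro equalityI subsetI)
    fix p assume "p \<in> {p. Y p = 0}"
    then have "p = P + (X p / d) *\<^sub>R (Q - P)"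
      using pt_X_Y[of p] d by (simp add: pt_def Q)
    then show "p \<in> range (\<lambda>s. P + s *\<^sub>R (Q - P))"
      by blast
  next
    fix p assume "p \<in> range (\<lambda>s. P + s *\<^sub>R (Q - P))"
    then show "p \<in> {p. Y p = 0}"
      by (auto simp: Q Y_def)
  qed
  finally show thesis
    using that orthonormal_frame_axioms by blast
qed

text \<open>Both centres have the same signed height \<open>\<sigma> * a\<close> over
  \<open>t\<close>, so \<open>c2 - c1\<close> is parallel to \<open>t\<close> and gives
  \<open>e\<close>; the sign \<open>\<sigma>\<close> turns the normal towards the circles.\<close>

lemma tangent_circles_frame:
  assumes a: "a > 0" and ext: "circles_touch_externally c1 a c2 a"
    and tan: "external_common_tangent t c1 a c2 a"
  obtains c0 e f where "orthonormal_frame e f" "t = {p. orthonormal_frame.Y c0 f p = 0}"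
    "c1 = orthonormal_frame.pt c0 e f (- a) a" "c2 = orthonormal_frame.pt c0 e f a a"
proof -
  have "is_line t"
    using tan by (simp add: external_common_tangent_def)
  then obtain P u v where frame: "orthonormal_frame u v" "t = {p. orthonormal_frame.Y P v p = 0}"
    by (rule line_eq_axis)
  interpret F: orthonormal_frame P u v by fact
  have "\<bar>F.Y c1\<bar> = a" "\<bar>F.Y c2\<bar> = a" "F.Y c1 * F.Y c2 > 0"
    using tan F.touches_axis_abs_Y F.same_side_axis
    by (auto simp: external_common_tangent_def frame(2))
  then obtain \<sigma> :: real where \<sigma>: "\<sigma> \<in> {1, - 1}" "F.Y c1 = \<sigma> * a" "F.Y c2 = \<sigma> * a"
    by (auto simp: abs_if zero_less_mult_iff split: if_splits intro: that[of 1] that[of "- 1"])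
  have dist: "norm (c2 - c1) = 2 * a"
    using touches_equal_radius_dist[of c1 a c2] ext
    by (simp add: circles_touch_externally_def dist_norm norm_minus_commute)
  define e where "e = (1 / (2 * a)) *\<^sub>R (c2 - c1)"
  define f where "f = \<sigma> *\<^sub>R v"
  \<comment> \<open>The contact point of the large circles, the midpoint of their centres, is
    projected to \<open>t\<close>.\<close>
  define c0 where "c0 = c1 + a *\<^sub>R e - a *\<^sub>R f"
  have c2: "c2 = c1 + (2 * a) *\<^sub>R e"
    using a by (simp add: e_def)
  have "(c2 - c1) \<bullet> v = F.Y c2 - F.Y c1"
    by (simp add: F.Y_def inner_simps)
  then have "e \<bullet> v = 0"
    using \<sigma> by (simp add: e_def)
  interpret G: orthonormal_frame c0 e f
    using a dist \<sigma>(1) F.norm_f \<open>e \<bullet> v = 0\<close> by unfold_locales (auto simp: e_def f_def)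
  \<comment> \<open>The new origin lies on \<open>t\<close>, so the heights in the two frames differ
    only by the sign \<open>\<sigma>\<close>.\<close>
  have "G.Y p = \<sigma> * F.Y p" for p
    using \<sigma> \<open>e \<bullet> v = 0\<close> unfolding G.Y_def F.Y_def by (auto simp: f_def c0_def inner_simps)
  then have "t = {p. G.Y p = 0}"
    using \<sigma>(1) by (auto simp: frame(2))
  moreover have "c1 = G.pt (- a) a" "c2 = G.pt a a"
    unfolding G.pt_def by (simp_all add: c0_def c2 algebra_simps flip: scaleR_2)
  ultimately show thesis
    using that G.orthonormal_frame_axioms by blast
qed

theorem theorem1:
  fixes a r :: real and c1 c2 A B C :: point and b :: "nat \<Rightarrow> point"
    and t :: "point set" and n :: nat
  assumes "a > 0"
    and "circles_touch_externally c1 a c2 a"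
    and "external_common_tangent t c1 a c2 a"
    and "n \<ge> 1"
    and "congruent_circles_on t n b r"
    and "\<And>i. i \<in> {1..n} \<Longrightarrow> sphere (b i) r \<subseteq> curvilinear_triangle c1 a c2 a t"
    and "touches_at (sphere (b 1) r) (sphere c1 a) C"
    and "touches_at (sphere (b n) r) (sphere c2 a) B"
    and "foot_of_perpendicular A B t"
  shows "real n * dist A B = dist B C
       \<and> 2 * a = ((sqrt (real n) + 1)\<^sup>2 + 1) * dist A B"
proof -
  obtain c0 e f where frame: "orthonormal_frame e f" "t = {p. orthonormal_frame.Y c0 f p = 0}"
    "c1 = orthonormal_frame.pt c0 e f (- a) a" "c2 = orthonormal_frame.pt c0 e f a a"
    using tangent_circles_frame[OF assms(1,2,3)] by metis
  interpret orthonormal_frame c0 e f by fact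
  show ?thesis
    using assms(4-9) unfolding frame(2-4) by (intro row_relations_in_frame[OF assms(1)]) auto
qed

end
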